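(* Let $\mathfrak{u}$ be a nonprincipal ultrafilter in $\mathbb{N}$, let $\mathbf{z}=(z_n)$ be a sequence in $\mathbb{D}$ with $\lim_{n\to\infty}|z_n|=1$ such that $(|z_n|)$ is strictly increasing, let $\mathbf{k}=(k_n)$ be a sequence in $\mathbb{N}$ and let $r\in(0,1)$. Suppose that $\varphi := \varphi_{\mathbf{z},\mathfrak{u}}^{\mathbf{k},r} = \lim_{\mathfrak{u}}\zeta_{D^+(z_n,\sqrt[k_n]{r})}$ belongs to $\mathfrak{M}'_0$. Then either $\varphi\in\mathfrak{M}_1$ or $\varphi=\|\cdot\|$.
   Context: $\mathbb{K}$ is an algebraically closed field, complete with respect to a nontrivial nonarchimedean absolute value $|\cdot|$; $\mathbb{D} = \{z \in \mathbb{K} : |z|<1\}$; $\mathbb{N}=\{1,2,\dots\}$. $H^\infty$ is the Banach $\mathbb{K}$-algebra of bounded power series $f(z)=\sum_{n\ge 0} a_n z^n$ on $\mathbb{D}$, with norm $\|f\| = \sup_n |a_n| = \sup_{z\in\mathbb{D}}|f(z)|$. $D^+(z,r)$ is the closed disk with center $z$ and radius $r$, and for a disk $D\subset\mathbb{D}$, $\zeta_D(f) := \sup_{z\in D}|f(z)|$ for $f\in H^\infty$ (a multiplicative seminorm bounded by $\|\cdot\|$). $\lim_{\mathfrak{u}}$ denotes the pointwise limit along $\mathfrak{u}$. A sequence $(z_n)$ in $\mathbb{D}$ is regular with respect to a nonprincipal ultrafilter $\mathfrak{u}$ if there is $C\in\mathfrak{u}$ with $\inf_{n\in C}\prod_{m\in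 C, m\ne n}|z_n-z_m|>0$. $\mathfrak{M}'_0$ is the set of all seminorms $\lim_{\mathfrak{u}} \zeta_{D^+(z_n,r_n)}$, where $\mathfrak{u}$ is a nonprincipal ultrafilter in $\mathbb{N}$, $(z_n)$ is a sequence in $\mathbb{D}$ with $\lim_{n\to\infty}|z_n|=1$ that is regular with respect to $\mathfrak{u}$, $(r_n)$ is a sequence in $(0,1)$, and for some $C\in\mathfrak{u}$ the disks $D^+(z_n,r_n)$, $n\in C$, are pairwise disjoint. $\mathtt{Comp}_{\mathfrak{u}}(\mathbf{z})$ is the set of all sequences $\mathbf{k}=(k_n)$ in $\mathbb{N}$ for which there is $C\in\mathfrak{u}$ with $\inf_{n\in C}\prod_{m\in C, m\ne n}|z_n-z_m|^{k_m}>0$. $\mathfrak{M}_1$ is the set of all seminorms $\lim_{\mathfrak{u}}\zeta_{D^+(z_n,\sqrt[k_n]{r})}$, where $\mathbf{z}$ ranges over sequences in $\mathbb{D}$, $\mathfrak{u}$ over nonprincipal ultrafilters in $\mathbb{N}$, $\mathbf{k}$ over $\mathtt{Comp}_{\mathfrak{u}}(\mathbf{z})$ and $r$ over $(0,1)$. *)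

theory Defs
  imports "HOL-Analysis.Analysis"
begin

text \<open>
  The library's normed fields are real algebras, which excludes nonarchimedean absolute values, and
  the library constant \<^const>\<open>norm\<close> is tied to them. The absolute value is therefore a new
  class parameter, which induces the metric (and hence the topology) of \<^class>\<open>complete_space\<close>.
\<close>

class nonarch_field = alg_closed_field + complete_space +
  fixes absval :: "'a \<Rightarrow> real"
  assumes dist_absval: "dist x y = absval (x - y)"
    and absval_eq_0: "absval x = 0 \<longleftrightarrow> x = 0"
    and absval_mult: "absval (x * y) = absval x * absval y"
    and absval_add: "absval (x + y) \<le> max (absval x) (absval y)"
    and absval_nontrivial: "\<exists>x. x \<noteq> 0 \<and> absval x \<noteq> 1"

abbreviation unit_disk :: "'k::nonarch_field set" where
  "unit_disk \<equiv> ball 0 1"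


definition ps_eval :: "'k::nonarch_field fps \<Rightarrow> 'k \<Rightarrow> 'k" where
  "ps_eval f z = (\<Sum>n. fps_nth f n * z ^ n)"

definition Hinf :: "'k::nonarch_field fps set" where
  "Hinf = {f. (\<forall>z\<in>unit_disk. summable (\<lambda>n. fps_nth f n * z ^ n)) \<and>
              bdd_above ((\<lambda>z. absval (ps_eval f z)) ` unit_disk)}"

text \<open>
  Seminorms on \<^const>\<open>Hinf\<close> are represented as functions that are \<^const>\<open>undefined\<close> outside
  \<^const>\<open>Hinf\<close>, so that equality of functions is equality of seminorms.
\<close>

definition Hinf_norm :: "'k::nonarch_field fps \<Rightarrow> real" where
  "Hinf_norm = (\<lambda>f\<in>Hinf. SUP n. absval (fps_nth f n))"

definition zeta :: "'k::nonarch_field set \<Rightarrow> 'k fps \<Rightarrow> real" where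
  "zeta D = (\<lambda>f\<in>Hinf. SUP z\<in>D. absval (ps_eval f z))"


text \<open>
  Ultrafilters are represented as library filters: a set \<open>C\<close> belongs to \<open>U\<close> iff
  \<open>\<forall>\<^sub>F n in U. n \<in> C\<close>. Sequences are indexed from \<open>0\<close>.
\<close>

definition nonprincipal_ultrafilter :: "nat filter \<Rightarrow> bool" where
  "nonprincipal_ultrafilter U \<longleftrightarrow>
     U \<noteq> bot \<and>
     (\<forall>C. (\<forall>\<^sub>F n in U. n \<in> C) \<or> (\<forall>\<^sub>F n in U. n \<in> - C)) \<and>
     (\<forall>m. \<not> (\<forall>\<^sub>F n in U. n \<in> {m}))"

definition lim_zeta ::
  "nat filter \<Rightarrow> (nat \<Rightarrow> 'k::nonarch_field) \<Rightarrow> (nat \<Rightarrow> real) \<Rightarrow> 'k fps \<Rightarrow> real" where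
  "lim_zeta U z r = (\<lambda>f\<in>Hinf. Lim U (\<lambda>n. zeta (cball (z n) (r n)) f))"


text \<open>
  Infinite products are limits of partial products. The library's \<^const>\<open>prodinf\<close> is not usable
  here, since it is unspecified for nonzero factors whose partial products tend to \<open>0\<close>. All factors
  below lie in \<open>[0, 1]\<close>, so that the limit exists and the infima are taken over sets bounded below.
\<close>

definition inf_prod :: "nat set \<Rightarrow> (nat \<Rightarrow> real) \<Rightarrow> real" where
  "inf_prod C a = lim (\<lambda>N. \<Prod>m\<in>C \<inter> {..<N}. a m)"

definition regular_wrt :: "nat filter \<Rightarrow> (nat \<Rightarrow> 'k::nonarch_field) \<Rightarrow> bool" where
  "regular_wrt U z \<longleftrightarrow>
     (\<exists>C. (\<forall>\<^sub>F n in U. n \<in> C) \<and>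
          (INF n\<in>C. inf_prod (C - {n}) (\<lambda>m. absval (z n - z m))) > 0)"

definition Comp :: "nat filter \<Rightarrow> (nat \<Rightarrow> 'k::nonarch_field) \<Rightarrow> (nat \<Rightarrow> nat) set" where
  "Comp U z =
     {k. (\<forall>n. k n \<ge> 1) \<and>
         (\<exists>C. (\<forall>\<^sub>F n in U. n \<in> C) \<and>
              (INF n\<in>C. inf_prod (C - {n}) (\<lambda>m. absval (z n - z m) ^ k m)) > 0)}"

definition M0' :: "('k::nonarch_field fps \<Rightarrow> real) set" where
  "M0' = {lim_zeta U z r | U z r.
            nonprincipal_ultrafilter U \<and>
            range z \<subseteq> unit_disk \<and>
            (\<lambda>n. absval (z n)) \<longlonglongrightarrow> 1 \<and>
            regular_wrt U z \<and>
            range r \<subseteq> {0<..<1} \<and>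
            (\<exists>C. (\<forall>\<^sub>F n in U. n \<in> C) \<and> disjoint_family_on (\<lambda>n. cball (z n) (r n)) C)}"

definition M1 :: "('k::nonarch_field fps \<Rightarrow> real) set" where
  "M1 = {lim_zeta U z (\<lambda>n. root (k n) r) | U z k r.
           range z \<subseteq> unit_disk \<and>
           nonprincipal_ultrafilter U \<and>
           k \<in> Comp U z \<and>
           r \<in> {0<..<1}}"

end

theory Submission
  imports Defs
begin

text \<open>
  Write \<open>\<rho> n\<close> for the \<open>k n\<close>-th root of \<open>r\<close>. Every \<open>\<zeta>\<close>-seminorm is bounded by the norm. So if
  the limit seminorm is not the norm, then some \<open>f\<close>, some \<open>\<theta> < \<parallel>f\<parallel>\<close> and some set in the
  ultrafilter satisfy \<open>\<zeta> (f) \<le> \<theta>\<close> on all disks \<open>cball (z n) (\<rho> n)\<close> with \<open>n\<close> in that set. Such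
  smallness has to be paid for with zeros. Fix \<open>y\<close> with \<open>\<eta> = \<bar>f(y)\<bar> > \<theta>\<close>. On the circle of radius
  \<open>\<bar>z n\<bar> > \<bar>y\<bar>\<close> the generic value of \<open>\<bar>f\<bar>\<close> is at least \<open>\<eta>\<close>, and passing from it to the disk
  \<open>cball (z n) (\<rho> n)\<close> decreases it at most by a factor \<open>\<rho> n\<close> for each of the \<open>N n\<close> zeros of \<open>f\<close> on
  that circle. Hence \<open>\<eta> \<rho>\<^sup>N \<le> \<theta>\<close> for \<open>N = N n\<close>, \<open>\<rho> = \<rho> n\<close>, and because the \<open>k n\<close>-th power of
  \<open>\<rho> n\<close> is always the same number \<open>r\<close>, this forces \<open>k n \<le> M * N n\<close> with a constant \<open>M\<close>.

  On the other hand the zeros of a bounded power series obey a Blaschke condition, which is the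
  nonarchimedean Jensen formula: the product of the \<open>\<bar>z n\<bar>\<close> with multiplicities \<open>N n\<close> is bounded below,
  since the circles are distinct. Therefore it stays bounded below with multiplicities \<open>k n\<close>. As the
  \<open>\<bar>z n\<bar>\<close> are distinct, \<open>\<bar>z n - z m\<bar>\<close> is the maximum of \<open>\<bar>z n\<bar>\<close> and \<open>\<bar>z m\<bar>\<close>, so the Blaschke
  condition alone already makes \<open>k\<close> compatible with \<open>z\<close> (\<open>mem_Comp_if_blaschke\<close>), and the limit
  seminorm lies in \<^const>\<open>M1\<close> by definition.

  Both estimates reduce to polynomials. Only finitely many circles matter at a time, and on a disk
  of radius less than \<open>1\<close> the function \<open>f\<close> is approximated by its partial sums, which split into
  linear factors. For these the estimates can be checked factor by factor
  (\<open>large_value_in_subdisk\<close>, \<open>gauss_jensen\<close>). The lemma \<open>zero_counts\<close> combines them; its bounds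
  do not depend on the chosen partial sum.
\<close>

section \<open>Nonarchimedean absolute values\<close>

lemma absval_nonneg: "0 \<le> absval (x :: 'k::nonarch_field)"
  using dist_absval[of x 0] by (metis diff_zero zero_le_dist)

lemma absval_0 [simp]: "absval (0 :: 'k::nonarch_field) = 0"
  by (simp add: absval_eq_0)

lemma absval_pos: "x \<noteq> 0 \<Longrightarrow> 0 < absval (x :: 'k::nonarch_field)"
  by (metis absval_eq_0 absval_nonneg order_le_less)

lemma absval_1 [simp]: "absval (1 :: 'k::nonarch_field) = 1"
  using absval_mult[of 1 "1 :: 'k"] absval_eq_0[of "1 :: 'k"] by simp

lemma absval_minus_commute: "absval (x - y) = absval (y - (x :: 'k::nonarch_field))"
  by (metis dist_absval dist_commute)

lemma absval_minus [simp]: "absval (- x) = absval (x :: 'k::nonarch_field)"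
  using absval_minus_commute[of 0 x] by simp

lemma absval_diff: "absval (x - y) \<le> max (absval x) (absval (y :: 'k::nonarch_field))"
  using absval_add[of x "- y"] by simp

lemma absval_diff_eq_max:
  assumes "absval x \<noteq> absval (y :: 'k::nonarch_field)"
  shows "absval (x - y) = max (absval x) (absval y)"
proof (rule antisym[OF absval_diff])
  have "absval x \<le> max (absval (x - y)) (absval y)" "absval y \<le> max (absval x) (absval (x - y))"
    using absval_add[of "x - y" y] absval_diff[of x "x - y"] by simp_all
  then show "max (absval x) (absval y) \<le> absval (x - y)"
    using assms by linarith
qed

lemma absval_power: "absval (x ^ n) = absval (x :: 'k::nonarch_field) ^ n"
  by (induction n) (simp_all add: absval_mult)

lemma absval_inverse: "absval (inverse x) = inverse (absval (x :: 'k::nonarch_field))"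
proof (cases "x = 0")
  case False
  then have "absval (inverse x) * absval x = 1"
    by (simp flip: absval_mult)
  then show ?thesis
    by (metis inverse_unique mult.commute)
qed simp

lemma absval_power_int: "absval (x powi n) = absval (x :: 'k::nonarch_field) powi n"
  by (cases n rule: int_cases4) (simp_all add: power_int_minus absval_inverse absval_power)

lemma absval_sum_le:
  fixes g :: "'i \<Rightarrow> 'k::nonarch_field"
  assumes "\<And>i. i \<in> I \<Longrightarrow> absval (g i) \<le> b" "0 \<le> b"
  shows "absval (sum g I) \<le> b"
  using assms
proof (induction I rule: infinite_finite_induct)
  case (insert i I)
  then show ?case
    using order_trans[OF absval_add[of "g i" "sum g I"], of b] by simp
qed auto

lemma absval_prod_mset: "absval (\<Prod>x\<in>#A. g x) = (\<Prod>x\<in>#A. absval (g x :: 'k::nonarch_field))"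
  by (induction A) (simp_all add: absval_mult)

text \<open>
  An algebraically closed field contains all roots of an element with absolute value greater
  than \<open>1\<close>, so the value group is divisible and, being nontrivial, dense.
\<close>

lemma dense_absval_pos:
  assumes "0 < a" "a < b"
  shows "\<exists>x :: 'k::nonarch_field. a < absval x \<and> absval x < b"
proof -
  obtain x0 :: 'k where x0: "x0 \<noteq> 0" "absval x0 \<noteq> 1"
    using absval_nontrivial by blast
  define x where "x = (if absval x0 > 1 then x0 else inverse x0)"
  have x: "absval x > 1"
    using x0 absval_pos[OF x0(1)] by (auto simp: x_def absval_inverse intro: one_less_inverse)
  let ?q = "absval x"
  have "log ?q a < log ?q b"
    using assms x by simp
  then obtain s where s: "s \<in> \<rat>" "log ?q a < s" "s < log ?q b"
    using Rats_dense_in_real by blast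
  obtain m :: int and n :: nat where mn: "s = of_int m / of_nat n" "n > 0"
    using s(1) by (metis Rats_cases' of_int_of_nat_eq pos_int_cases of_nat_0_less_iff)
  obtain y where y: "y ^ n = x"
    using nth_root_exists[OF mn(2)] by blast
  have yn: "absval y ^ n = ?q"
    using y by (simp flip: absval_power)
  then have y0: "absval y > 0"
    using x absval_nonneg[of y] mn(2) by (metis less_eq_real_def not_one_less_zero zero_power)
  have "?q powr s = (absval y powr n) powr s"
    using yn y0 by (simp add: powr_realpow)
  also have "\<dots> = absval y powr of_int m"
    using mn by (simp add: powr_powr)
  also have "\<dots> = absval (y powi m)"
    using y0 by (simp add: powr_real_of_int' absval_power_int)
  finally have *: "absval (y powi m) = ?q powr s" by simp
  have "a < ?q powr s" "?q powr s < b"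
    using s x assms by (simp_all add: log_less_iff less_log_iff)
  then show ?thesis
    using * by metis
qed

lemma dense_absval_avoiding:
  assumes "0 \<le> a" "a < b" "finite F"
  shows "\<exists>x :: 'k::nonarch_field. a < absval x \<and> absval x < b \<and> absval x \<notin> F"
proof -
  define a' where "a' = Max (insert a (insert (b / 2) (F \<inter> {..<b})))"
  have fin: "finite (insert a (insert (b / 2) (F \<inter> {..<b})))"
    using assms by simp
  have "a' < b"
    unfolding a'_def using assms fin by (subst Max_less_iff) auto
  moreover have "a \<le> a'" "b / 2 \<le> a'" and F: "\<And>s. s \<in> F \<Longrightarrow> s < b \<Longrightarrow> s \<le> a'"
    unfolding a'_def by (rule Max_ge[OF fin], simp)+
  moreover have "0 < a'"
    using \<open>b / 2 \<le> a'\<close> assms by linarith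
  ultimately obtain x :: 'k where "a' < absval x" "absval x < b"
    using dense_absval_pos by metis
  then show ?thesis
    using F \<open>a \<le> a'\<close> by (meson le_less_trans linorder_not_le)
qed

text \<open>
  Points at a distance from the center \<open>z\<close> that avoids the finitely many numbers \<open>\<bar>z - \<alpha>\<bar>\<close> are as far
  from every \<open>\<alpha>\<close> as the ultrametric inequality permits. Their values replace maxima over disks and
  circles, which need not be attained for a given radius.
\<close>

lemma generic_point:
  fixes z :: "'k::nonarch_field"
  assumes "0 \<le> a" "a < b"
  shows "\<exists>x. a < absval (x - z) \<and> absval (x - z) < b \<and>
             (\<forall>\<alpha>\<in>#A. absval (x - \<alpha>) = max (absval (z - \<alpha>)) (absval (x - z)))"
proof -
  obtain h :: 'k where h: "a < absval h" "absval h < b"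
      "absval h \<notin> (\<lambda>\<alpha>. absval (z - \<alpha>)) ` set_mset A"
    using dense_absval_avoiding[OF assms, of "(\<lambda>\<alpha>. absval (z - \<alpha>)) ` set_mset A"] by auto
  have "absval (z + h - \<alpha>) = max (absval (z - \<alpha>)) (absval h)" if "\<alpha> \<in># A" for \<alpha>
  proof -
    have "absval (z - \<alpha>) \<noteq> absval (- h)"
      using h(3) that by force
    from absval_diff_eq_max[OF this] show ?thesis
      by (simp add: algebra_simps)
  qed
  then show ?thesis
    using h by (intro exI[of _ "z + h"]) simp
qed


section \<open>Products of linear factors\<close>

text \<open>
  The Gauss norm, at radius \<open>t\<close>, of the monic polynomial with the multiset \<open>A\<close> of roots.
\<close>

definition gauss :: "'k::nonarch_field multiset \<Rightarrow> real \<Rightarrow> real" where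
  "gauss A t = (\<Prod>\<alpha>\<in>#A. max (absval \<alpha>) t)"

lemma gauss_nonneg: "0 \<le> t \<Longrightarrow> 0 \<le> gauss A t"
  unfolding gauss_def by (induction A) (auto simp: absval_nonneg intro!: mult_nonneg_nonneg)

lemma prod_mset_nonneg_absval: "0 \<le> (\<Prod>\<alpha>\<in>#A. absval (x - \<alpha> :: 'k::nonarch_field))"
  by (induction A) (simp_all add: absval_nonneg)

lemma gauss_mono:
  assumes "0 \<le> s" "s \<le> t"
  shows "gauss A s \<le> gauss A t"
proof (induction A)
  case (add \<alpha> A)
  have "max (absval \<alpha>) s * gauss A s \<le> max (absval \<alpha>) t * gauss A t"
    using assms add gauss_nonneg[of s A] by (intro mult_mono) auto
  then show ?case
    by (simp add: gauss_def)
qed (simp add: gauss_def)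

lemma absval_prod_le_gauss:
  assumes "absval y \<le> t"
  shows "(\<Prod>\<alpha>\<in>#A. absval (y - \<alpha>)) \<le> gauss A t"
proof (induction A)
  case (add \<alpha> A)
  have "absval (y - \<alpha>) \<le> max (absval \<alpha>) t"
    using absval_diff[of y \<alpha>] assms by linarith
  then have "absval (y - \<alpha>) * (\<Prod>\<alpha>\<in>#A. absval (y - \<alpha>)) \<le> max (absval \<alpha>) t * gauss A t"
    using add prod_mset_nonneg_absval[of y A] by (intro mult_mono) (auto simp: absval_nonneg le_max_iff_disj)
  then show ?case
    by (simp add: gauss_def)
qed (simp add: gauss_def)

lemma gauss_attained:
  assumes "0 \<le> a" "a < b"
  shows "\<exists>x. a < absval x \<and> absval x < b \<and> (\<Prod>\<alpha>\<in>#A. absval (x - \<alpha>)) = gauss A (absval x)"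
proof -
  obtain x where "a < absval x" "absval x < b" "\<forall>\<alpha>\<in>#A. absval (x - \<alpha>) = max (absval \<alpha>) (absval x)"
    using generic_point[OF assms, of 0 A] by auto
  then show ?thesis
    unfolding gauss_def by (intro exI[of _ x]) (auto intro!: arg_cong[of _ _ prod_mset] image_mset_cong)
qed

text \<open>
  Together with \<open>gauss_attained\<close> this bounds coefficients by values. The induction
  multiplies by one linear factor at a time: by the ultrametric inequality a coefficient of the
  product is at most the larger of its two summands.
\<close>

lemma coeff_le_gauss:
  assumes "0 \<le> t"
  shows "absval (coeff (\<Prod>\<alpha>\<in>#A. [:- \<alpha>, 1:]) j) * t ^ j \<le> gauss A t"
proof (induction A arbitrary: j)
  case empty
  then show ?case
    by (cases j) (simp_all add: gauss_def)
next
  case (add \<alpha> A)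
  define Q where "Q = (\<Prod>\<alpha>\<in>#A. [:- \<alpha>, 1:])"
  let ?q = "\<lambda>i. absval (coeff Q i)" and ?m = "max (absval \<alpha>) t"
  have IH: "?q i * t ^ i \<le> gauss A t" for i
    unfolding Q_def by (rule add)
  have low: "absval \<alpha> * ?q i * t ^ i \<le> ?m * gauss A t" for i
    using mult_mono[OF max.cobounded1[of "absval \<alpha>" t] IH[of i]] assms
    by (simp add: mult.assoc absval_nonneg le_max_iff_disj)
  have "absval (coeff ([:- \<alpha>, 1:] * Q) j) * t ^ j \<le> ?m * gauss A t"
  proof (cases j)
    case 0
    then show ?thesis using low[of 0] by (simp add: absval_mult)
  next
    case (Suc i)
    have "?q i * t ^ j \<le> ?m * gauss A t"
      using mult_mono[OF max.cobounded2[of t "absval \<alpha>"] IH[of i]] assms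
      by (simp add: Suc absval_nonneg le_max_iff_disj mult_ac)
    moreover have "absval (coeff ([:- \<alpha>, 1:] * Q) j) \<le> max (?q i) (absval \<alpha> * ?q j)"
      using absval_diff[of "coeff Q i" "\<alpha> * coeff Q j"] by (simp add: Suc absval_mult)
    then have "absval (coeff ([:- \<alpha>, 1:] * Q) j) * t ^ j \<le> max (?q i) (absval \<alpha> * ?q j) * t ^ j"
      using assms by (intro mult_right_mono) auto
    ultimately show ?thesis
      using low[of j] by (auto simp: max_def split: if_splits)
  qed
  then show ?case
    by (simp add: gauss_def Q_def)
qed

definition circle_roots :: "'k::nonarch_field multiset \<Rightarrow> real \<Rightarrow> nat" where
  "circle_roots A t = size (filter_mset (\<lambda>\<alpha>. absval \<alpha> = t) A)"

text \<open>
  Take \<open>x\<close> at a generic distance between \<open>a\<close> and \<open>\<rho>\<close> from \<open>z\<close>. A root off the circle through \<open>z\<close>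
  contributes to the value at \<open>x\<close> the full factor that it contributes to the Gauss norm; a root on the
  circle contributes at least \<open>a\<close> instead of \<open>\<bar>z\<bar>\<close>.
\<close>

lemma large_value_in_subdisk:
  fixes z :: "'k::nonarch_field"
  assumes "0 < a" "a < \<rho>" "\<rho> \<le> absval z"
  shows "\<exists>x. absval (x - z) < \<rho> \<and>
             gauss A (absval z) * a ^ circle_roots A (absval z) \<le>
             (\<Prod>\<alpha>\<in>#A. absval (x - \<alpha>)) * absval z ^ circle_roots A (absval z)"
proof -
  let ?t = "absval z"
  obtain x where x: "a < absval (x - z)" "absval (x - z) < \<rho>"
      "\<forall>\<alpha>\<in>#A. absval (x - \<alpha>) = max (absval (z - \<alpha>)) (absval (x - z))"
    using generic_point[of a \<rho> z A] assms by auto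
  have "gauss A ?t * a ^ circle_roots A ?t \<le> (\<Prod>\<alpha>\<in>#A. absval (x - \<alpha>)) * ?t ^ circle_roots A ?t"
    using x(3)
  proof (induction A)
    case (add \<alpha> A)
    let ?p = "\<Prod>\<alpha>\<in>#A. absval (x - \<alpha>)" and ?N = "circle_roots A ?t"
    have xa: "absval (x - \<alpha>) = max (absval (z - \<alpha>)) (absval (x - z))"
      using add.prems by simp
    have IH: "gauss A ?t * a ^ ?N \<le> ?p * ?t ^ ?N"
      using add by simp
    have g0: "0 \<le> gauss A ?t * a ^ ?N"
      using gauss_nonneg[OF absval_nonneg, of A z] assms by simp
    show ?case
    proof (cases "absval \<alpha> = ?t")
      case True
      have "a \<le> absval (x - \<alpha>)"
        using xa x(1) by linarith
      then have "(?t * a) * (gauss A ?t * a ^ ?N) \<le> (?t * absval (x - \<alpha>)) * (?p * ?t ^ ?N)"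
        using assms by (intro mult_mono[OF mult_left_mono IH _ g0]) (auto simp: absval_nonneg)
      then show ?thesis
        by (simp add: True gauss_def circle_roots_def mult_ac)
    next
      case False
      have "max (absval \<alpha>) ?t \<le> absval (x - \<alpha>)"
        using xa absval_diff_eq_max[of z \<alpha>] False by auto
      then have "max (absval \<alpha>) ?t * (gauss A ?t * a ^ ?N) \<le> absval (x - \<alpha>) * (?p * ?t ^ ?N)"
        by (intro mult_mono[OF _ IH _ g0]) (auto simp: absval_nonneg)
      then show ?thesis
        using False by (simp add: gauss_def circle_roots_def mult_ac)
    qed
  qed (simp add: gauss_def circle_roots_def)
  then show ?thesis
    using x(2) by blast
qed

text \<open>
  One root \<open>\<alpha>\<close> with \<open>\<bar>\<alpha>\<bar> = t n\<close> contributes \<open>1\<close> to the Gauss norm at radius \<open>1\<close> but only \<open>t n\<close> to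
  the Gauss norm at radius \<open>s\<close>. Since \<open>t\<close> is injective, no root is counted for two indices.
\<close>

lemma gauss_jensen:
  fixes t :: "'i \<Rightarrow> real"
  assumes "finite F" "inj_on t F" "\<And>n. n \<in> F \<Longrightarrow> s \<le> t n" "\<And>n. n \<in> F \<Longrightarrow> t n \<le> 1"
    "0 \<le> s" "s \<le> 1"
  shows "gauss A s \<le> gauss A 1 * (\<Prod>n\<in>F. t n ^ circle_roots A (t n))"
proof (induction A)
  case (add \<alpha> A)
  define w where "w = (\<Prod>n\<in>F. if absval \<alpha> = t n then t n else 1)"
  let ?q = "\<Prod>n\<in>F. t n ^ circle_roots A (t n)"
  have split: "(\<Prod>n\<in>F. t n ^ circle_roots (add_mset \<alpha> A) (t n)) = w * ?q"
    unfolding w_def by (auto simp: circle_roots_def simp flip: prod.distrib intro!: prod.cong)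
  have "max (absval \<alpha>) s \<le> max (absval \<alpha>) 1 * w"
  proof (cases "absval \<alpha> \<in> t ` F")
    case True
    then obtain m where m: "m \<in> F" "absval \<alpha> = t m" by blast
    have "w = (\<Prod>n\<in>F. if n = m then t m else 1)"
      unfolding w_def using m assms(2) by (intro prod.cong) (auto simp: inj_on_def)
    also have "\<dots> = t m"
      using m assms(1) by (simp add: prod.delta)
    finally show ?thesis
      using m assms(3)[of m] assms(4)[of m] by simp
  next
    case False
    then have "w = 1"
      unfolding w_def by (intro prod.neutral) auto
    then show ?thesis
      using assms by auto
  qed
  then have "max (absval \<alpha>) s * gauss A s \<le> (max (absval \<alpha>) 1 * w) * (gauss A 1 * ?q)"
    using add gauss_nonneg[OF assms(5), of A] assms(5) by (intro mult_mono) auto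
  then show ?case
    unfolding split by (simp add: gauss_def mult_ac)
qed (simp add: gauss_def circle_roots_def)


section \<open>Bounded power series\<close>

definition trunc :: "nat \<Rightarrow> 'k::nonarch_field fps \<Rightarrow> 'k poly" where
  "trunc d f = (\<Sum>i<d. monom (fps_nth f i) i)"

lemma coeff_trunc: "coeff (trunc d f) i = (if i < d then fps_nth f i else 0)"
  by (simp add: trunc_def coeff_sum if_distrib cong: if_cong)

lemma poly_trunc: "poly (trunc d f) x = (\<Sum>i<d. fps_nth f i * x ^ i)"
  by (simp add: trunc_def poly_sum poly_monom)

lemma mem_unit_disk: "x \<in> unit_disk \<longleftrightarrow> absval x < 1"
  by (simp add: dist_absval)

text \<open>
  Generic points lie strictly inside a disk, so estimates come with an arbitrary radius \<open>a < \<rho>\<close>, and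
  this passes to the limit.
\<close>

lemma limit_bound_power:
  fixes c S \<rho> :: real
  assumes "\<And>a. 0 < a \<Longrightarrow> a < \<rho> \<Longrightarrow> c * a ^ N \<le> S" "0 < \<rho>"
  shows "c * \<rho> ^ N \<le> S"
proof (rule tendsto_upperbound)
  show "((\<lambda>a. c * a ^ N) \<longlongrightarrow> c * \<rho> ^ N) (at_left \<rho>)"
    by (intro tendsto_intros)
  show "\<forall>\<^sub>F a in at_left \<rho>. c * a ^ N \<le> S"
    using eventually_at_left_real[OF assms(2)] by eventually_elim (use assms(1) in auto)
qed simp

lemma linear_factorization:
  assumes "p \<noteq> (0 :: 'k::nonarch_field poly)"
  shows "\<exists>A c. p = smult c (\<Prod>\<alpha>\<in>#A. [:- \<alpha>, 1:]) \<and>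
               (\<forall>x. absval (poly p x) = absval c * (\<Prod>\<alpha>\<in>#A. absval (x - \<alpha>)))"
proof -
  obtain A where A: "size A = degree p" "p = smult (lead_coeff p) (\<Prod>\<alpha>\<in>#A. [:- \<alpha>, 1:])"
    using alg_closed_imp_factorization[OF assms] by blast
  have "absval (poly p x) = absval (lead_coeff p) * (\<Prod>\<alpha>\<in>#A. absval (x - \<alpha>))" for x
    by (subst A(2)) (simp add: poly_prod_mset absval_mult absval_prod_mset)
  then show ?thesis
    using A by metis
qed

text \<open>
  Convergence at a point \<open>b\<close> of absolute value between \<open>R\<close> and \<open>1\<close> makes the terms small there, and
  hence uniformly small on the disk of radius \<open>R\<close>; an ultrametric sum is no larger than its largest
  term.
\<close>

lemma truncation_approximates:
  fixes f :: "'k::nonarch_field fps"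
  assumes f: "f \<in> Hinf" and R: "0 \<le> R" "R < 1" and e: "0 < \<epsilon>"
  shows "\<forall>\<^sub>F d in sequentially. \<forall>x. absval x \<le> R \<longrightarrow> absval (ps_eval f x - poly (trunc d f) x) \<le> \<epsilon>"
proof -
  obtain b :: 'k where b: "R < absval b" "absval b < 1"
    using dense_absval_avoiding[OF R, of "{}"] by auto
  have sums: "(\<lambda>d. poly (trunc d f) x) \<longlonglongrightarrow> ps_eval f x" if "absval x < 1" for x
    using f that summable_sums[of "\<lambda>n. fps_nth f n * x ^ n"]
    by (simp add: Hinf_def ps_eval_def sums_def poly_trunc dist_absval)
  have "Cauchy (\<lambda>d. poly (trunc d f) b)"
    by (rule LIMSEQ_imp_Cauchy[OF sums[OF b(2)]])
  then obtain M where M: "\<And>m n. m \<ge> M \<Longrightarrow> n \<ge> M \<Longrightarrow>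
      absval (poly (trunc m f) b - poly (trunc n f) b) < \<epsilon>"
    using e unfolding Cauchy_def dist_absval by blast
  have small: "absval (fps_nth f i) * absval b ^ i \<le> \<epsilon>" if "i \<ge> M" for i
    using M[of "Suc i" i] that by (simp add: poly_trunc absval_mult absval_power)
  show ?thesis
    unfolding eventually_sequentially
  proof (intro exI[of _ M] allI impI)
    fix d x assume d: "M \<le> d" and x: "absval (x :: 'k) \<le> R"
    have "absval (poly (trunc n f) x - poly (trunc d f) x) \<le> \<epsilon>" if "n \<ge> d" for n
    proof -
      have "poly (trunc n f) x - poly (trunc d f) x = (\<Sum>i\<in>{d..<n}. fps_nth f i * x ^ i)"
        unfolding poly_trunc using sum_diff_nat_ivl[of 0 d n "\<lambda>i. fps_nth f i * x ^ i"] that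
        by (simp add: atLeast0LessThan)
      also have "absval \<dots> \<le> \<epsilon>"
      proof (rule absval_sum_le)
        fix i assume i: "i \<in> {d..<n}"
        have "absval (fps_nth f i) * absval x ^ i \<le> absval (fps_nth f i) * absval b ^ i"
          using x b by (intro mult_left_mono power_mono) (auto simp: absval_nonneg)
        then show "absval (fps_nth f i * x ^ i) \<le> \<epsilon>"
          using small[of i] i d by (simp add: absval_mult absval_power)
      qed (use e in simp)
      finally show ?thesis .
    qed
    then have "\<forall>\<^sub>F n in sequentially. dist (poly (trunc n f) x) (poly (trunc d f) x) \<le> \<epsilon>"
      unfolding dist_absval eventually_sequentially by blast
    moreover have "(\<lambda>n. dist (poly (trunc n f) x) (poly (trunc d f) x)) \<longlonglongrightarrow>
        dist (ps_eval f x) (poly (trunc d f) x)"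
      using sums[of x] x R by (intro tendsto_dist) auto
    ultimately have "dist (ps_eval f x) (poly (trunc d f) x) \<le> \<epsilon>"
      by (intro tendsto_upperbound[OF _ _ sequentially_bot])
    then show "absval (ps_eval f x - poly (trunc d f) x) \<le> \<epsilon>"
      by (simp add: dist_absval)
  qed
qed

text \<open>
  At a generic point of absolute value above \<open>a\<close>, a long partial sum takes a value as large
  as its Gauss norm, which dominates the term of index \<open>j\<close>; the error of the partial sum is at most
  \<open>S\<close> and disappears in the ultrametric maximum.
\<close>

lemma cauchy_estimate:
  fixes f :: "'k::nonarch_field fps"
  assumes f: "f \<in> Hinf" and S: "0 < S" "\<And>x. absval x < 1 \<Longrightarrow> absval (ps_eval f x) \<le> S"
  shows "absval (fps_nth f j) \<le> S"
proof -
  have "absval (fps_nth f j) * a ^ j \<le> S" if a: "0 < a" "a < 1" for a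
  proof (cases "fps_nth f j = 0")
    case False
    define R where "R = (a + 1) / 2"
    have R: "a < R" "R < 1" "0 \<le> R"
      using a by (simp_all add: R_def)
    obtain d where d: "d > j"
        "\<And>x. absval x \<le> R \<Longrightarrow> absval (ps_eval f x - poly (trunc d f) x) \<le> S"
      using eventually_conj[OF eventually_gt_at_top[of j] truncation_approximates[OF f R(3,2) S(1)]]
      by (auto simp: eventually_sequentially)
    have cj: "coeff (trunc d f) j = fps_nth f j"
      using d(1) by (simp add: coeff_trunc)
    then have "trunc d f \<noteq> 0"
      using False by auto
    then obtain A c where P: "trunc d f = smult c (\<Prod>\<alpha>\<in>#A. [:- \<alpha>, 1:])"
        "\<And>x. absval (poly (trunc d f) x) = absval c * (\<Prod>\<alpha>\<in>#A. absval (x - \<alpha>))"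
      using linear_factorization by metis
    obtain x where x: "a < absval x" "absval x < R"
        "(\<Prod>\<alpha>\<in>#A. absval (x - \<alpha>)) = gauss A (absval x)"
      using gauss_attained[of a R A] a R by auto
    have "absval (fps_nth f j) * a ^ j \<le> absval (fps_nth f j) * absval x ^ j"
      using x a by (intro mult_left_mono power_mono) (auto simp: absval_nonneg)
    also have "\<dots> = absval c * (absval (coeff (\<Prod>\<alpha>\<in>#A. [:- \<alpha>, 1:]) j) * absval x ^ j)"
      by (subst cj[symmetric], subst P(1)) (simp add: absval_mult)
    also have "\<dots> \<le> absval c * gauss A (absval x)"
      by (intro mult_left_mono coeff_le_gauss absval_nonneg)
    also have "\<dots> = absval (poly (trunc d f) x)"
      using x by (simp add: P(2))
    also have "\<dots> \<le> max (absval (ps_eval f x)) (absval (ps_eval f x - poly (trunc d f) x))"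
      using absval_diff[of "ps_eval f x" "ps_eval f x - poly (trunc d f) x"] by simp
    also have "\<dots> \<le> S"
      using d(2)[of x] S(2)[of x] x R by simp
    finally show ?thesis .
  qed (use S in auto)
  from limit_bound_power[of 1 "absval (fps_nth f j)" j S, OF this] show ?thesis
    by simp
qed

lemma Hinf_bounded_on_disk:
  assumes "f \<in> Hinf" "D \<subseteq> unit_disk"
  shows "bdd_above ((\<lambda>z. absval (ps_eval f z)) ` D)"
proof (rule bdd_above_mono)
  show "bdd_above ((\<lambda>z. absval (ps_eval f z)) ` unit_disk)"
    using assms(1) by (simp add: Hinf_def)
qed (use assms(2) in blast)

text \<open>
  The norm is a supremum of reals, so this needs the coefficients to be bounded, which the Cauchy
  estimate derives from the boundedness of the values.
\<close>

lemma absval_coeff_le_norm: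
  fixes f :: "'k::nonarch_field fps"
  assumes "f \<in> Hinf"
  shows "absval (fps_nth f j) \<le> Hinf_norm f"
proof -
  obtain S0 where S0: "\<And>x. absval x < 1 \<Longrightarrow> absval (ps_eval f x) \<le> S0"
    using Hinf_bounded_on_disk[OF assms subset_refl] mem_unit_disk
    unfolding bdd_above_def by (metis imageI)
  have "absval (fps_nth f i) \<le> max S0 1" for i
    by (rule cauchy_estimate[OF assms]) (use S0 in \<open>auto simp: le_max_iff_disj\<close>)
  then have "bdd_above (range (\<lambda>i. absval (fps_nth f i)))"
    by (intro bdd_aboveI[of _ "max S0 1"]) auto
  then show ?thesis
    using assms by (auto simp: Hinf_norm_def intro: cSUP_upper)
qed

lemma absval_eval_le_norm:
  fixes f :: "'k::nonarch_field fps"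
  assumes f: "f \<in> Hinf" and x: "absval x < 1"
  shows "absval (ps_eval f x) \<le> Hinf_norm f"
proof (rule field_le_epsilon)
  fix e :: real assume e: "0 < e"
  have B0: "0 \<le> Hinf_norm f"
    using absval_coeff_le_norm[OF f, of 0] absval_nonneg order_trans by blast
  obtain d where d: "absval (ps_eval f x - poly (trunc d f) x) \<le> e"
    using truncation_approximates[OF f absval_nonneg x e] by (auto simp: eventually_sequentially)
  have "absval (poly (trunc d f) x) \<le> Hinf_norm f"
    unfolding poly_trunc
  proof (rule absval_sum_le[OF _ B0])
    fix i
    have "absval (fps_nth f i) * absval x ^ i \<le> Hinf_norm f * 1"
      using absval_coeff_le_norm[OF f, of i] x B0
      by (intro mult_mono power_le_one) (auto simp: absval_nonneg)
    then show "absval (fps_nth f i * x ^ i) \<le> Hinf_norm f"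
      by (simp add: absval_mult absval_power)
  qed
  then show "absval (ps_eval f x) \<le> Hinf_norm f + e"
    using absval_add[of "ps_eval f x - poly (trunc d f) x" "poly (trunc d f) x"] d B0 e by auto
qed

lemma norm_approached:
  fixes f :: "'k::nonarch_field fps"
  assumes f: "f \<in> Hinf" and \<theta>: "0 < \<theta>" "\<theta> < Hinf_norm f"
  shows "\<exists>y. absval y < 1 \<and> \<theta> < absval (ps_eval f y)"
proof (rule ccontr)
  assume "\<not> ?thesis"
  then have "absval (fps_nth f j) \<le> \<theta>" for j
    by (intro cauchy_estimate[OF f \<theta>(1)]) (meson not_less)
  then have "Hinf_norm f \<le> \<theta>"
    using f by (auto simp: Hinf_norm_def intro: cSUP_least)
  then show False
    using \<theta> by simp
qed

lemma zeta_upper: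
  assumes "f \<in> Hinf" "D \<subseteq> unit_disk" "x \<in> D"
  shows "absval (ps_eval f x) \<le> zeta D f"
  using assms Hinf_bounded_on_disk[OF assms(1,2)] by (auto simp: zeta_def intro: cSUP_upper)

lemma zeta_le_norm:
  assumes "f \<in> Hinf" "D \<subseteq> unit_disk" "D \<noteq> {}"
  shows "zeta D f \<le> Hinf_norm f"
  using assms by (auto simp: zeta_def mem_unit_disk dist_absval intro!: cSUP_least absval_eval_le_norm)

lemma cball_subset_unit_disk:
  assumes "absval (z :: 'k::nonarch_field) < 1" "\<rho> < 1"
  shows "cball z \<rho> \<subseteq> unit_disk"
proof
  fix x assume "x \<in> cball z \<rho>"
  then have "absval (z - (z - x)) < 1"
    using assms absval_diff[of z "z - x"] by (simp add: dist_absval)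
  then show "x \<in> unit_disk"
    by (simp add: dist_absval)
qed


section \<open>Multiplicities forced by small values\<close>

text \<open>
  Here \<open>N n\<close> is the number of roots on the circle through \<open>z n\<close> of a partial sum \<open>p\<close> that approximates
  \<open>f\<close> up to \<open>\<theta>\<close> on a disk containing \<open>y\<close> and all the \<open>z n\<close>. The error \<open>\<theta>\<close> is small enough not to
  change the absolute value at \<open>y\<close>, nor the bound \<open>\<theta>\<close> on the disks. Neither bound refers to \<open>p\<close>, so
  they can be used for larger and larger finite sets \<open>F\<close>.
\<close>

lemma zero_counts:
  fixes f :: "'k::nonarch_field fps" and z :: "'i \<Rightarrow> 'k"
  assumes f: "f \<in> Hinf" and y: "absval y < 1" and \<theta>: "0 < \<theta>" "\<theta> < absval (ps_eval f y)"
    and F: "finite F" "inj_on (\<lambda>n. absval (z n)) F"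
    and z: "\<And>n. n \<in> F \<Longrightarrow> absval y < absval (z n)" "\<And>n. n \<in> F \<Longrightarrow> absval (z n) < 1"
    and \<rho>: "\<And>n. n \<in> F \<Longrightarrow> 0 < \<rho> n" "\<And>n. n \<in> F \<Longrightarrow> \<rho> n < 1"
    and zeta: "\<And>n. n \<in> F \<Longrightarrow> zeta (cball (z n) (\<rho> n)) f \<le> \<theta>"
  shows "\<exists>N. (\<forall>n\<in>F. absval (ps_eval f y) * \<rho> n ^ N n \<le> \<theta>) \<and>
             absval (ps_eval f y) \<le> 2 * Hinf_norm f * (\<Prod>n\<in>F. absval (z n) ^ N n)"
proof -
  let ?\<eta> = "absval (ps_eval f y)"
  define R where "R = Max (insert (absval y) ((\<lambda>n. absval (z n)) ` F))"
  have R: "R < 1" "absval y \<le> R" "\<And>n. n \<in> F \<Longrightarrow> absval (z n) \<le> R"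
    unfolding R_def using F(1) y z(2) by (simp_all add: Max_ge del: Max_insert)
  have R0: "0 \<le> R"
    using R(2) absval_nonneg[of y] by linarith
  obtain d where d: "\<And>x. absval x \<le> R \<Longrightarrow> absval (ps_eval f x - poly (trunc d f) x) \<le> \<theta>"
    using truncation_approximates[OF f R0 R(1) \<theta>(1)] by (auto simp: eventually_sequentially)
  define p where "p = trunc d f"
  have py: "absval (poly p y) = ?\<eta>"
    using absval_diff_eq_max[of "ps_eval f y" "ps_eval f y - poly p y"] d[OF R(2)] \<theta>
    by (simp add: p_def)
  then have "p \<noteq> 0"
    using \<theta> by auto
  then obtain A and c :: 'k
    where P: "\<And>x. absval (poly p x) = absval c * (\<Prod>\<alpha>\<in>#A. absval (x - \<alpha>))"
    using linear_factorization by blast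
  define N where "N = (\<lambda>n. circle_roots A (absval (z n)))"
  have \<eta>: "?\<eta> \<le> absval c * gauss A t" if "absval y \<le> t" for t
    unfolding py[symmetric] P by (intro mult_left_mono absval_prod_le_gauss that absval_nonneg)
  have "?\<eta> * \<rho> n ^ N n \<le> \<theta>" if n: "n \<in> F" for n
  proof (rule limit_bound_power)
    let ?D = "cball (z n) (\<rho> n)" and ?t = "absval (z n)"
    have D: "?D \<subseteq> unit_disk"
      by (rule cball_subset_unit_disk[OF z(2)[OF n] \<rho>(2)[OF n]])
    (* If the radius exceeded that of the circle through the center, the disk would contain y,
       where f is larger than theta. *)
    have "y \<notin> ?D"
      using zeta_upper[OF f D, of y] zeta[OF n] \<theta> by auto
    then have \<rho>t: "\<rho> n \<le> ?t"
      using absval_diff[of "z n" y] z(1)[OF n] by (simp add: dist_absval)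
    fix a assume a: "0 < a" "a < \<rho> n"
    obtain x where x: "absval (x - z n) < \<rho> n"
        "gauss A ?t * a ^ N n \<le> (\<Prod>\<alpha>\<in>#A. absval (x - \<alpha>)) * ?t ^ N n"
      using large_value_in_subdisk[OF a \<rho>t, of A] unfolding N_def by blast
    have "absval x \<le> R"
      using absval_add[of "x - z n" "z n"] x(1) \<rho>t R(3)[OF n] by simp
    moreover have "x \<in> ?D"
      using x(1) absval_minus_commute[of x "z n"] by (simp add: dist_absval)
    ultimately have "absval (poly p x) \<le> \<theta>"
      using absval_diff[of "ps_eval f x" "ps_eval f x - poly p x"] d[of x] zeta_upper[OF f D, of x]
        zeta[OF n] by (simp add: p_def)
    have "?\<eta> * a ^ N n \<le> (absval c * gauss A ?t) * a ^ N n"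
      using \<eta>[of ?t] z(1)[OF n] a by (intro mult_right_mono) auto
    also have "\<dots> \<le> absval c * ((\<Prod>\<alpha>\<in>#A. absval (x - \<alpha>)) * ?t ^ N n)"
      using mult_left_mono[OF x(2) absval_nonneg[of c]] by (simp add: mult.assoc)
    also have "\<dots> = absval (poly p x) * ?t ^ N n"
      by (simp add: P)
    also have "\<dots> \<le> \<theta> * 1"
      using \<open>absval (poly p x) \<le> \<theta>\<close> z(2)[OF n] \<theta>
      by (intro mult_mono power_le_one) (auto simp: absval_nonneg)
    finally show "?\<eta> * a ^ N n \<le> \<theta>"
      by simp
  qed (use \<rho> n in auto)
  moreover have "?\<eta> \<le> 2 * Hinf_norm f * (\<Prod>n\<in>F. absval (z n) ^ N n)"
  proof -
    have B0: "0 \<le> Hinf_norm f"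
      using absval_eval_le_norm[OF f y] absval_nonneg[of "ps_eval f y"] by linarith
    (* The Gauss norm of p at radius 1 is read off from a point of absolute value just above 1;
       the choice of b keeps all powers up to the degree below 2, whence the factor 2. *)
    let ?b = "root (Suc d) 2"
    obtain x where x: "1 < absval x" "absval x < ?b"
        "(\<Prod>\<alpha>\<in>#A. absval (x - \<alpha>)) = gauss A (absval x)"
      using gauss_attained[of 1 ?b A] by auto
    have "absval x ^ Suc d \<le> ?b ^ Suc d"
      using x by (intro power_mono) auto
    also have "?b ^ Suc d = 2"
      by (rule real_root_pow_pos2) auto
    finally have xd: "absval x ^ Suc d \<le> 2" .
    have "absval c * gauss A 1 \<le> absval (poly p x)"
      unfolding P x(3) using x(1) by (intro mult_left_mono gauss_mono absval_nonneg) auto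
    also have "\<dots> \<le> Hinf_norm f * 2"
      unfolding p_def poly_trunc
    proof (rule absval_sum_le)
      fix i assume "i \<in> {..<d}"
      then have "absval x ^ i \<le> absval x ^ Suc d"
        using x(1) by (intro power_increasing) auto
      then show "absval (fps_nth f i * x ^ i) \<le> Hinf_norm f * 2"
        unfolding absval_mult absval_power
        using xd absval_coeff_le_norm[OF f, of i] B0 by (intro mult_mono) (auto simp: absval_nonneg)
    qed (use B0 in simp)
    finally have c1: "absval c * gauss A 1 \<le> 2 * Hinf_norm f"
      by simp
    have "gauss A (absval y) \<le> gauss A 1 * (\<Prod>n\<in>F. absval (z n) ^ N n)"
      unfolding N_def using z y
      by (intro gauss_jensen F) (auto simp: absval_nonneg intro: less_imp_le)
    then have "?\<eta> \<le> absval c * (gauss A 1 * (\<Prod>n\<in>F. absval (z n) ^ N n))"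
      using \<eta>[of "absval y"] mult_left_mono[OF _ absval_nonneg[of c]] by fastforce
    also have "\<dots> \<le> 2 * Hinf_norm f * (\<Prod>n\<in>F. absval (z n) ^ N n)"
      unfolding mult.assoc[symmetric] using c1
      by (intro mult_right_mono prod_nonneg) (auto simp: absval_nonneg)
    finally show ?thesis .
  qed
  ultimately show ?thesis
    by blast
qed

lemma root_multiplicity_le:
  fixes \<rho> :: real
  assumes "0 < \<rho>" "\<rho> < 1" "\<rho> ^ N \<le> \<kappa>" "\<kappa> ^ M \<le> \<rho> ^ k"
  shows "k \<le> N * M"
proof (rule ccontr)
  assume "\<not> ?thesis"
  then have "\<rho> ^ k < \<rho> ^ (N * M)"
    using assms by (simp add: power_strict_decreasing)
  also have "\<dots> \<le> \<kappa> ^ M"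
    unfolding power_mult using assms by (intro power_mono) auto
  finally show False
    using assms(4) by simp
qed

section \<open>Compatible multiplicities\<close>

lemma inf_prod_ge:
  assumes "\<And>m. m \<in> C \<Longrightarrow> 0 \<le> a m" "\<And>m. m \<in> C \<Longrightarrow> a m \<le> 1"
    and "\<And>M. \<delta> \<le> (\<Prod>m\<in>C \<inter> {..<M}. a m)"
  shows "\<delta> \<le> inf_prod C a"
proof -
  let ?P = "\<lambda>M. \<Prod>m\<in>C \<inter> {..<M}. a m"
  have "?P (Suc M) \<le> ?P M" for M
  proof -
    have "C \<inter> {..<Suc M} = (if M \<in> C then insert M (C \<inter> {..<M}) else C \<inter> {..<M})"
      by (auto simp: less_Suc_eq)
    moreover have "0 \<le> ?P M"
      using assms(1) by (intro prod_nonneg) auto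
    ultimately show ?thesis
      using assms(1,2) by (auto intro: mult_left_le_one_le)
  qed
  then have "decseq ?P"
    by (rule decseq_SucI)
  then have "convergent ?P"
    using assms(3) by (metis decseq_convergent convergentI)
  then show ?thesis
    unfolding inf_prod_def convergent_LIMSEQ_iff
    by (rule LIMSEQ_le_const) (use assms(3) in auto)
qed

text \<open>
  For distinct absolute values, \<open>\<bar>z n - z m\<bar> \<ge> \<bar>z m\<bar>\<close>, so every product in the definition of
  \<^const>\<open>Comp\<close> is bounded below by the Blaschke product, uniformly in \<open>n\<close>.
\<close>

lemma mem_Comp_if_blaschke:
  fixes z :: "nat \<Rightarrow> 'k::nonarch_field"
  assumes U: "U \<noteq> bot" "\<forall>\<^sub>F n in U. n \<in> C"
    and z: "\<And>n. absval (z n) < 1" "inj (\<lambda>n. absval (z n))"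
    and k: "\<And>n. 1 \<le> k n"
    and \<delta>: "0 < \<delta>" "\<And>M. \<delta> \<le> (\<Prod>m\<in>C \<inter> {..<M}. absval (z m) ^ k m)"
  shows "k \<in> Comp U z"
proof -
  have dist: "absval (z m) \<le> absval (z n - z m)" "absval (z n - z m) \<le> 1" if "n \<noteq> m" for n m
  proof -
    have "absval (z n - z m) = max (absval (z n)) (absval (z m))"
      using that z(2) by (intro absval_diff_eq_max) (auto dest: injD)
    then show "absval (z m) \<le> absval (z n - z m)" "absval (z n - z m) \<le> 1"
      using z(1)[of n] z(1)[of m] by auto
  qed
  have "\<delta> \<le> inf_prod (C - {n}) (\<lambda>m. absval (z n - z m) ^ k m)" for n
  proof (rule inf_prod_ge)
    fix M
    let ?I = "C \<inter> {..<M}" and ?w = "\<lambda>m. absval (z m) ^ k m"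
    have I: "(C - {n}) \<inter> {..<M} = ?I - {n}"
      by auto
    have "prod ?w ?I \<le> prod ?w (?I - {n})"
    proof (cases "n \<in> ?I")
      case True
      have "?w n * prod ?w (?I - {n}) \<le> prod ?w (?I - {n})"
        using z(1)[of n] by (intro mult_left_le_one_le prod_nonneg power_le_one)
          (auto simp: absval_nonneg intro: less_imp_le)
      then show ?thesis
        using True by (subst prod.remove[of _ n]) auto
    qed simp
    also have "\<dots> \<le> (\<Prod>m\<in>?I - {n}. absval (z n - z m) ^ k m)"
      using dist by (intro prod_mono conjI power_mono) (auto simp: absval_nonneg)
    finally show "\<delta> \<le> (\<Prod>m\<in>(C - {n}) \<inter> {..<M}. absval (z n - z m) ^ k m)"
      unfolding I using \<delta>(2)[of M] by linarith
  qed (use dist in \<open>auto simp: absval_nonneg intro!: power_le_one\<close>)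
  moreover have "C \<noteq> {}"
    using U by auto
  ultimately have "\<delta> \<le> (INF n\<in>C. inf_prod (C - {n}) (\<lambda>m. absval (z n - z m) ^ k m))"
    by (intro cINF_greatest) auto
  then show ?thesis
    unfolding Comp_def using U(2) k \<delta>(1) by force
qed

lemma nonprincipal_le_sequentially:
  assumes "nonprincipal_ultrafilter U"
  shows "U \<le> sequentially"
proof -
  have "\<forall>\<^sub>F n in U. n \<noteq> m" for m
    using assms unfolding nonprincipal_ultrafilter_def by (metis (mono_tags, lifting) ComplD
      eventually_mono singletonI)
  then have "\<forall>\<^sub>F n in U. M \<le> n" for M
    using eventually_ball_finite[of "{..<M}" "\<lambda>n m. n \<noteq> m" U]
    by (auto elim!: eventually_mono simp: not_less[symmetric])
  then show ?thesis
    unfolding le_filter_def eventually_sequentially by (meson eventually_mono)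
qed

theorem corollary2p10:
  fixes U :: "nat filter"
    and z :: "nat \<Rightarrow> 'k::nonarch_field"
    and k :: "nat \<Rightarrow> nat"
    and r :: real
  assumes "nonprincipal_ultrafilter U"
    and "range z \<subseteq> unit_disk"
    and "(\<lambda>n. absval (z n)) \<longlonglongrightarrow> 1"
    and "strict_mono (\<lambda>n. absval (z n))"
    and "\<And>n. k n \<ge> 1"
    and "r \<in> {0<..<1}"
    and "lim_zeta U z (\<lambda>n. root (k n) r) \<in> M0'"
  shows "lim_zeta U z (\<lambda>n. root (k n) r) \<in> M1 \<or>
         lim_zeta U z (\<lambda>n. root (k n) r) = Hinf_norm"
proof (rule disjCI)
  define \<rho> where "\<rho> = (\<lambda>n. root (k n) r)"
  have r: "0 < r" "r < 1"
    using assms(6) by auto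
  have k: "0 < k n" for n
    using assms(5)[of n] by linarith
  have \<rho>: "0 < \<rho> n" "\<rho> n < 1" "\<rho> n ^ k n = r" for n
    using k[of n] r by (simp_all add: \<rho>_def real_root_lt_1_iff)
  have z1: "absval (z n) < 1" for n
    using assms(2) mem_unit_disk by blast
  have inj: "inj (\<lambda>n. absval (z n))"
    using assms(4) by (rule strict_mono_imp_inj_on)
  have U: "U \<noteq> bot" "\<And>C. (\<forall>\<^sub>F n in U. n \<in> C) \<or> (\<forall>\<^sub>F n in U. n \<in> - C)"
    using assms(1) by (auto simp: nonprincipal_ultrafilter_def)
  let ?Z = "\<lambda>f n. zeta (cball (z n) (\<rho> n)) f"
  assume "lim_zeta U z (\<lambda>n. root (k n) r) \<noteq> Hinf_norm"
  then obtain f where f: "f \<in> Hinf" and neq: "Lim U (?Z f) \<noteq> Hinf_norm f"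
    by (auto simp: lim_zeta_def Hinf_norm_def \<rho>_def restrict_def fun_eq_iff split: if_splits)
  have D: "cball (z n) (\<rho> n) \<subseteq> unit_disk" "z n \<in> cball (z n) (\<rho> n)" for n
    using cball_subset_unit_disk[OF z1 \<rho>(2)] \<rho>(1)[of n] by simp_all
  (* Since U is an ultrafilter, failure of convergence means staying away from the limit on a set
     of U, even before the limit is known to exist. *)
  have "\<not> (?Z f \<longlongrightarrow> Hinf_norm f) U"
    using neq tendsto_Lim U(1) by blast
  then obtain e where e: "0 < e" "\<not> (\<forall>\<^sub>F n in U. dist (?Z f n) (Hinf_norm f) < e)"
    unfolding tendsto_iff by blast
  have "\<forall>\<^sub>F n in U. \<not> dist (?Z f n) (Hinf_norm f) < e"
    using e(2) U(2)[of "{n. dist (?Z f n) (Hinf_norm f) < e}"] by simp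
  then have small: "\<forall>\<^sub>F n in U. ?Z f n \<le> Hinf_norm f - e"
  proof (rule eventually_mono)
    fix n assume "\<not> dist (?Z f n) (Hinf_norm f) < e"
    then show "?Z f n \<le> Hinf_norm f - e"
      using zeta_le_norm[OF f D(1)[of n]] D(2)[of n] by (auto simp: dist_real_def)
  qed
  then obtain n0 where "?Z f n0 \<le> Hinf_norm f - e"
    using U(1) eventually_happens by blast
  then have norm_ge: "e \<le> Hinf_norm f"
    using zeta_upper[OF f D(1) D(2), of n0] absval_nonneg[of "ps_eval f (z n0)"] by linarith
  (* Subtracting only half of e keeps theta positive when the norm of f equals e. *)
  define \<theta> where "\<theta> = Hinf_norm f - e / 2"
  have \<theta>: "0 < \<theta>" "\<theta> < Hinf_norm f"
    using norm_ge e(1) by (auto simp: \<theta>_def)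
  obtain y where y: "absval y < 1" "\<theta> < absval (ps_eval f y)"
    using norm_approached[OF f \<theta>] by blast
  let ?\<eta> = "absval (ps_eval f y)"
  define C where "C = {n. ?Z f n \<le> \<theta> \<and> absval y < absval (z n)}"
  have "\<forall>\<^sub>F n in U. absval y < absval (z n)"
    using order_tendstoD(1)[OF assms(3) y(1)] nonprincipal_le_sequentially[OF assms(1)]
    by (rule filter_leD[rotated])
  with small have C: "\<forall>\<^sub>F n in U. n \<in> C"
    by eventually_elim (use e(1) in \<open>auto simp: C_def \<theta>_def\<close>)
  obtain M where M: "(\<theta> / ?\<eta>) ^ M < r"
    using real_arch_pow_inv[OF r(1), of "\<theta> / ?\<eta>"] \<theta> y by auto
  define \<delta> where "\<delta> = (?\<eta> / (2 * Hinf_norm f)) ^ M"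
  have blaschke: "\<delta> \<le> (\<Prod>m\<in>C \<inter> {..<L}. absval (z m) ^ k m)" for L
  proof -
    let ?F = "C \<inter> {..<L}"
    have "\<exists>N. (\<forall>n\<in>?F. ?\<eta> * \<rho> n ^ N n \<le> \<theta>) \<and>
              ?\<eta> \<le> 2 * Hinf_norm f * (\<Prod>n\<in>?F. absval (z n) ^ N n)"
      by (rule zero_counts[OF f y(1) \<theta>(1) y(2)])
        (use inj_on_subset[OF inj subset_UNIV] z1 \<rho> in \<open>auto simp: C_def\<close>)
    then obtain N where N: "\<And>n. n \<in> ?F \<Longrightarrow> ?\<eta> * \<rho> n ^ N n \<le> \<theta>"
        "?\<eta> \<le> 2 * Hinf_norm f * (\<Prod>n\<in>?F. absval (z n) ^ N n)"
      by blast
    have "k n \<le> N n * M" if "n \<in> ?F" for n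
    proof (rule root_multiplicity_le)
      show "\<rho> n ^ N n \<le> \<theta> / ?\<eta>"
        using N(1)[OF that] \<theta> y by (simp add: field_simps)
      show "(\<theta> / ?\<eta>) ^ M \<le> \<rho> n ^ k n"
        using M \<rho>(3)[of n] by simp
    qed (use \<rho> in auto)
    then have "(\<Prod>m\<in>?F. absval (z m) ^ (N m * M)) \<le> (\<Prod>m\<in>?F. absval (z m) ^ k m)"
      by (intro prod_mono conjI power_decreasing zero_le_power)
        (auto simp: absval_nonneg less_imp_le[OF z1])
    moreover have "\<delta> \<le> (\<Prod>m\<in>?F. absval (z m) ^ N m) ^ M"
      unfolding \<delta>_def using N(2) \<theta>
      by (intro power_mono divide_nonneg_pos) (simp_all add: absval_nonneg divide_le_eq mult.commute)
    ultimately show ?thesis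
      by (simp add: power_mult prod_power_distrib)
  qed
  have "0 < \<delta>"
    using \<theta> y by (simp add: \<delta>_def)
  then have "k \<in> Comp U z"
    by (rule mem_Comp_if_blaschke[OF U(1) C z1 inj assms(5) _ blaschke])
  then show "lim_zeta U z (\<lambda>n. root (k n) r) \<in> M1"
    unfolding M1_def using assms(1,2,6)
    by (intro CollectI exI[of _ U] exI[of _ z] exI[of _ k] exI[of _ r] conjI refl)
qed

end
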